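(* Let $G = \mathbb{F}_2$ be the free group on two generators. There exists a function $F : G \to [1/4,3/4]$ such that the Bernoulli action $G \curvearrowright (X,\mu) = \prod_{g \in G} (\{0,1\},\mu_g)$ with $\mu_g(0) = F(g)$ is nonsingular, essentially free and dissipative.
   Context: The Bernoulli action is $(g\cdot x)_h = x_{g^{-1}h}$. Nonsingular means preserving the measure class of $\mu$. A nonsingular action $G \curvearrowright (X,\mu)$ is dissipative if there exists a Borel set $\mathcal{U} \subset X$ such that all $g \cdot \mathcal{U}$, $g \in G$, are disjoint and $\bigcup_{g \in G} g \cdot \mathcal{U} = X$ up to measure zero. *)

theory Defs
  imports "HOL-Probability.Probability" "HOL-Algebra.Group_Action"
begin

section \<open>Free groups as groups of reduced words\<close>

text \<open>
  A letter \<open>(a, True)\<close> stands for the generator \<open>a\<close> and \<open>(a, False)\<close> for its inverse;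
  the elements of the free group on the type \<open>'a\<close> are the reduced words.
\<close>

definition letter_inv :: "'a \<times> bool \<Rightarrow> 'a \<times> bool" where
  "letter_inv x = (fst x, \<not> snd x)"

definition reduced_word :: "('a \<times> bool) list \<Rightarrow> bool" where
  "reduced_word w \<longleftrightarrow> successively (\<lambda>x y. y \<noteq> letter_inv x) w"

text \<open>Left multiplication of a reduced word by a letter, cancelling if necessary.\<close>

fun push_letter :: "'a \<times> bool \<Rightarrow> ('a \<times> bool) list \<Rightarrow> ('a \<times> bool) list" where
  "push_letter x [] = [x]"
| "push_letter x (y # w) = (if y = letter_inv x then w else x # y # w)"

definition free_group :: "('a \<times> bool) list monoid" where
  "free_group = \<lparr>carrier = {w. reduced_word w}, mult = foldr push_letter, one = []\<rparr>"

lemma letter_inv_letter_inv [simp]: "letter_inv (letter_inv x) = x"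
  by (simp add: letter_inv_def)

lemma letter_inv_neq [simp]: "letter_inv x \<noteq> x" "x \<noteq> letter_inv x"
  by (cases x; simp add: letter_inv_def)+

lemma letter_inv_eq_swap: "y = letter_inv x \<longleftrightarrow> x = letter_inv y"
  by (cases x, cases y) (auto simp: letter_inv_def)

lemma reduced_Nil [simp]: "reduced_word []"
  by (simp add: reduced_word_def)

lemma reduced_Cons: "reduced_word (x # w) \<longleftrightarrow> reduced_word w \<and> (w = [] \<or> hd w \<noteq> letter_inv x)"
  by (auto simp: reduced_word_def successively_Cons)

lemma reduced_push: "reduced_word w \<Longrightarrow> reduced_word (push_letter x w)"
  by (cases w) (auto simp: reduced_Cons)

lemma reduced_foldr_push: "reduced_word v \<Longrightarrow> reduced_word (foldr push_letter u v)"
  by (induction u) (auto intro: reduced_push)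

lemma push_letter_inv: "reduced_word w \<Longrightarrow> push_letter x (push_letter (letter_inv x) w) = w"
  by (cases w) (auto simp: reduced_Cons neq_Nil_conv split: if_splits, metis list.exhaust list.sel(1) push_letter.simps)

lemma foldr_push_push:
  assumes "reduced_word u" "reduced_word v"
  shows "foldr push_letter (push_letter x u) v = push_letter x (foldr push_letter u v)"
proof (cases u)
  case (Cons y w)
  show ?thesis
  proof (cases "y = letter_inv x")
    case True
    then show ?thesis
      using Cons push_letter_inv[OF reduced_foldr_push[OF assms(2)], of x w] by simp
  qed (use Cons in simp)
qed simp

lemma foldr_push_assoc:
  assumes "reduced_word u" "reduced_word v" "reduced_word w"
  shows "foldr push_letter (foldr push_letter u v) w = foldr push_letter u (foldr push_letter v w)"
  using assms
  by (induction u) (auto simp: reduced_Cons foldr_push_push reduced_foldr_push)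

lemma foldr_push_Nil: "reduced_word u \<Longrightarrow> foldr push_letter u [] = u"
proof (induction u)
  case (Cons x u)
  then have "foldr push_letter u [] = u" by (simp add: reduced_Cons)
  with Cons.prems show ?case by (cases u) (auto simp: reduced_Cons)
qed simp

lemma reduced_inverse: "reduced_word u \<Longrightarrow> reduced_word (rev (map letter_inv u))"
  by (auto simp: reduced_word_def successively_map letter_inv_eq_swap elim!: successively_mono)

lemma foldr_push_inverse: "reduced_word u \<Longrightarrow> foldr push_letter (rev (map letter_inv u)) u = []"
  by (induction u) (auto simp: reduced_Cons letter_inv_eq_swap neq_Nil_conv)

lemma group_free_group: "group free_group"
proof (rule groupI)
  fix x :: "('a \<times> bool) list" assume "x \<in> carrier free_group"
  then show "\<exists>y\<in>carrier free_group. y \<otimes>\<^bsub>free_group\<^esub> x = \<one>\<^bsub>free_group\<^esub>"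
    by (intro bexI[of _ "rev (map letter_inv x)"])
       (auto simp: free_group_def foldr_push_inverse reduced_inverse)
qed (auto simp: free_group_def reduced_foldr_push foldr_push_assoc)

text \<open>The universal property.\<close>

lemma free_group_universal:
  fixes H :: "('b, 'c) monoid_scheme" and f :: "'a \<Rightarrow> 'b"
    and h k :: "('a \<times> bool) list \<Rightarrow> 'b"
  assumes "group H" and f: "\<And>a. f a \<in> carrier H"
  shows "\<exists>h \<in> hom free_group H. \<forall>a. h [(a, True)] = f a"
    and "\<lbrakk>h \<in> hom free_group H; k \<in> hom free_group H; \<And>a. h [(a, True)] = k [(a, True)]; reduced_word w\<rbrakk>
           \<Longrightarrow> h w = k w"
proof -
  interpret H: group H by fact
  define val where "val x = (if snd x then f (fst x) else inv\<^bsub>H\<^esub> f (fst x))" for x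
  have val [simp]: "val x \<in> carrier H" for x
    by (simp add: val_def f)
  have val_inv: "val (letter_inv x) = inv\<^bsub>H\<^esub> val x" for x
    by (simp add: val_def letter_inv_def f)
  define ext where "ext w = foldr (\<lambda>x r. val x \<otimes>\<^bsub>H\<^esub> r) w \<one>\<^bsub>H\<^esub>" for w
  have ext [simp]: "ext w \<in> carrier H" for w
    by (induction w) (auto simp: ext_def)
  have ext_Cons: "ext (x # w) = val x \<otimes>\<^bsub>H\<^esub> ext w" for x w
    by (simp add: ext_def)
  have ext_push: "ext (push_letter x w) = val x \<otimes>\<^bsub>H\<^esub> ext w" for x w
    by (cases w) (auto simp: ext_Cons val_inv H.m_assoc [symmetric])
  have ext_mult: "ext (foldr push_letter u v) = ext u \<otimes>\<^bsub>H\<^esub> ext v" for u v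
    by (induction u) (auto simp: ext_push ext_Cons H.m_assoc, simp add: ext_def)
  have "ext \<in> hom free_group H"
    by (auto simp: hom_def free_group_def ext_mult)
  moreover have "ext [(a, True)] = f a" for a
    by (simp add: ext_def val_def f)
  ultimately show "\<exists>h \<in> hom free_group H. \<forall>a. h [(a, True)] = f a"
    by blast
next
  assume h: "h \<in> hom free_group H" and k: "k \<in> hom free_group H"
    and eq: "\<And>a. h [(a, True)] = k [(a, True)]"
  interpret h: group_hom free_group H h
    using h assms(1) group_free_group by (simp add: group_hom_def group_hom_axioms_def)
  interpret k: group_hom free_group H k
    using k assms(1) group_free_group by (simp add: group_hom_def group_hom_axioms_def)
  have c: "[x] \<in> carrier free_group" for x :: "'a \<times> bool"
    by (simp add: free_group_def reduced_Cons)
  have i: "[(a, False)] = inv\<^bsub>free_group\<^esub> [(a, True)]" for a :: 'a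
    by (rule h.G.inv_equality [symmetric])
       (simp_all add: c, simp add: free_group_def letter_inv_def)
  have l: "h [x] = k [x]" for x
  proof (cases x)
    case (Pair a b)
    then show ?thesis
      by (cases b) (simp_all add: eq i h.hom_inv k.hom_inv c)
  qed
  show "reduced_word w \<Longrightarrow> h w = k w"
  proof (induction w)
    case Nil
    show ?case using h.hom_one k.hom_one by (simp add: free_group_def)
  next
    case (Cons x w)
    then have w: "w \<in> carrier free_group" "x # w = [x] \<otimes>\<^bsub>free_group\<^esub> w"
      by (cases w; auto simp: free_group_def reduced_Cons)+
    have "h w = k w"
      using Cons by (simp add: reduced_Cons)
    then show ?case
      unfolding w(2) by (simp only: h.hom_mult k.hom_mult c w(1) l)
  qed
qed

text \<open>\<open>\<F>\<^sub>2\<close>; the two elements of \<^typ>\<open>bool\<close> serve as the names of the two generators.\<close>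

abbreviation F2 :: "(bool \<times> bool) list monoid" where
  "F2 \<equiv> free_group"


section \<open>Group actions on measure spaces\<close>

text \<open>
  Nonsingularity: every group element acts measurably and preserves the measure class, that is,
  \<open>g\<^sub>*\<mu>\<close> and \<open>\<mu>\<close> have the same null sets.
\<close>

definition nonsingular_action ::
  "('g, 'c) monoid_scheme \<Rightarrow> 'x measure \<Rightarrow> ('g \<Rightarrow> 'x \<Rightarrow> 'x) \<Rightarrow> bool" where
  "nonsingular_action G M \<phi> \<longleftrightarrow>
     group_action G (space M) \<phi> \<and>
     (\<forall>g\<in>carrier G. \<phi> g \<in> measurable M M \<and> null_sets (distr M M (\<phi> g)) = null_sets M)"

definition essentially_free ::
  "('g, 'c) monoid_scheme \<Rightarrow> 'x measure \<Rightarrow> ('g \<Rightarrow> 'x \<Rightarrow> 'x) \<Rightarrow> bool" where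
  "essentially_free G M \<phi> \<longleftrightarrow> (AE x in M. stabilizer G \<phi> x = {\<one>\<^bsub>G\<^esub>})"

definition dissipative ::
  "('g, 'c) monoid_scheme \<Rightarrow> 'x measure \<Rightarrow> ('g \<Rightarrow> 'x \<Rightarrow> 'x) \<Rightarrow> bool" where
  "dissipative G M \<phi> \<longleftrightarrow>
     (\<exists>U\<in>sets M. disjoint_family_on (\<lambda>g. \<phi> g ` U) (carrier G) \<and>
                 (AE x in M. x \<in> (\<Union>g\<in>carrier G. \<phi> g ` U)))"


section \<open>Bernoulli actions with base space \<open>{0, 1}\<close>\<close>

definition two_point_measure :: "real \<Rightarrow> nat measure" where
  "two_point_measure p = point_measure {0, 1} (\<lambda>i. ennreal (if i = 0 then p else 1 - p))"

definition bernoulli_space :: "('g, 'c) monoid_scheme \<Rightarrow> ('g \<Rightarrow> real) \<Rightarrow> ('g \<Rightarrow> nat) measure" where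
  "bernoulli_space G F = (\<Pi>\<^sub>M g\<in>carrier G. two_point_measure (F g))"

text \<open>
  \<open>(g \<cdot> x)\<^sub>h = x\<^bsub>g\<^sup>-\<^sup>1h\<^esub>\<close>. The restrictions make \<open>g \<cdot> x\<close> an element of the extensional product
  \<open>\<Pi>\<^sub>E h\<in>carrier G. {0, 1}\<close> and the map \<open>x \<mapsto> g \<cdot> x\<close> an element of \<^const>\<open>BijGroup\<close>.
\<close>

definition bernoulli_action :: "('g, 'c) monoid_scheme \<Rightarrow> 'g \<Rightarrow> ('g \<Rightarrow> nat) \<Rightarrow> ('g \<Rightarrow> nat)" where
  "bernoulli_action G g =
     (\<lambda>x\<in>carrier G \<rightarrow>\<^sub>E {0, 1}. \<lambda>h\<in>carrier G. x (inv\<^bsub>G\<^esub> g \<otimes>\<^bsub>G\<^esub> h))"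

lemma prob_space_two_point_measure:
  assumes "0 \<le> p" "p \<le> 1"
  shows "prob_space (two_point_measure p)"
  using assms
  by (intro prob_spaceI)
     (simp add: two_point_measure_def space_point_measure emeasure_point_measure_finite
        flip: ennreal_plus)

lemma space_bernoulli_space: "space (bernoulli_space G F) = carrier G \<rightarrow>\<^sub>E {0, 1}"
  by (simp add: bernoulli_space_def space_PiM two_point_measure_def space_point_measure)

lemma group_action_bernoulli:
  assumes "group G"
  shows "group_action G (space (bernoulli_space G F)) (bernoulli_action G)"
proof -
  interpret group G by fact
  let ?E = "carrier G \<rightarrow>\<^sub>E {0, 1::nat}"
  have closed: "bernoulli_action G g x \<in> ?E" if "g \<in> carrier G" "x \<in> ?E" for g x
    using that by (auto simp: bernoulli_action_def PiE_iff)
  have comp: "bernoulli_action G g (bernoulli_action G h x) = bernoulli_action G (g \<otimes>\<^bsub>G\<^esub> h) x"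
    if "g \<in> carrier G" "h \<in> carrier G" "x \<in> ?E" for g h x
    using that closed[OF that(2,3)]
    by (auto simp: bernoulli_action_def fun_eq_iff inv_mult_group m_assoc PiE_iff)
  have one: "bernoulli_action G \<one>\<^bsub>G\<^esub> x = x" if "x \<in> ?E" for x
    using that by (auto simp: bernoulli_action_def fun_eq_iff PiE_iff extensional_def)
  have bij: "bernoulli_action G g \<in> Bij ?E" if g: "g \<in> carrier G" for g
  proof -
    have "bij_betw (bernoulli_action G g) ?E ?E"
      by (rule bij_betw_byWitness[where f' = "bernoulli_action G (inv\<^bsub>G\<^esub> g)"])
         (use g closed in \<open>simp_all add: comp one image_subset_iff\<close>)
    then show ?thesis by (simp add: Bij_def bernoulli_action_def)
  qed
  have "bernoulli_action G \<in> hom G (BijGroup ?E)"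
  proof (rule homI)
    fix g h assume gh: "g \<in> carrier G" "h \<in> carrier G"
    show "bernoulli_action G (g \<otimes>\<^bsub>G\<^esub> h) =
        bernoulli_action G g \<otimes>\<^bsub>BijGroup ?E\<^esub> bernoulli_action G h"
    proof
      fix x
      show "bernoulli_action G (g \<otimes>\<^bsub>G\<^esub> h) x =
          (bernoulli_action G g \<otimes>\<^bsub>BijGroup ?E\<^esub> bernoulli_action G h) x"
      proof (cases "x \<in> ?E")
        case True
        then show ?thesis using gh bij by (simp add: BijGroup_def compose_def comp)
      next
        case False
        then have "bernoulli_action G (g \<otimes>\<^bsub>G\<^esub> h) x = undefined"
          unfolding bernoulli_action_def by (rule restrict_apply[THEN trans, OF if_not_P])
        with False show ?thesis using gh bij by (simp add: BijGroup_def compose_def)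
      qed
    qed
  qed (use bij in \<open>simp add: BijGroup_def\<close>)
  then show ?thesis
    unfolding space_bernoulli_space group_action_def group_hom_def group_hom_axioms_def
    using group_BijGroup is_group by blast
qed

end

theory Submission
  imports Defs "HOL-Library.Fun_Lexorder"
begin

text \<open>
  Write \<open>p(i, a)\<close> for the mass that coordinate \<open>i\<close> gives to \<open>a\<close> and suppose that left translation by each \<open>g\<close>
  changes \<open>F\<close> at finitely many points only. Then \<open>g\<inverse>\<^sub>*\<mu>\<close> has the density
  \<open>\<omega>\<^sub>g(x) = \<Prod>\<^sub>h p(g h, x\<^sub>h) / p(h, x\<^sub>h)\<close> with respect to \<open>\<mu>\<close>, a finite product of positive factors. So the
  Bernoulli action is nonsingular, and \<open>\<omega>\<close> is a cocycle: \<open>\<omega>\<^bsub>g h\<^esub>(x) = \<omega>\<^sub>g(h x) \<omega>\<^sub>h(x)\<close> for every \<open>x\<close>.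

  The expectation of \<open>\<surd>\<omega>\<^sub>g\<close> factorizes as well. Each changed coordinate contributes the Bhattacharyya
  affinity of the old and the new marginal, which is at most \<open>\<rho> = 287/288\<close> when these differ by at least
  \<open>1/6\<close>. By Markov's inequality, \<open>\<mu>(\<omega>\<^sub>g \<ge> 1) \<le> \<rho>\<^bsup>d(g)\<^esup>\<close>, where \<open>d(g)\<close> counts the points at which
  translation by \<open>g\<close> changes \<open>F\<close>. There are at most \<open>4\<^bsup>n\<^esup>\<close> group elements of length \<open>n\<close>, so if \<open>d(g)\<close> is at least
  a large multiple of \<open>n - 1\<close> for each of them, then Borel-Cantelli shows that for almost every \<open>x\<close> only
  finitely many \<open>g\<close> satisfy \<open>\<omega>\<^sub>g(x) \<ge> 1\<close>.

  Such an \<open>F\<close> exists although its values are confined to \<open>[1/4, 3/4]\<close>: let \<open>F h\<close> encode the letter of \<open>h\<close>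
  that stands \<open>m\<close> places before the last one. Left multiplication does not affect the end of a long word,
  so only finitely many points change. If \<open>g = p s\<close> is a proper splitting and \<open>v\<close> is a word of length \<open>m\<close>, then
  generically \<open>F (s\<inverse> v)\<close> encodes the last letter of \<open>s\<inverse>\<close> and \<open>F (g s\<inverse> v) = F (p v)\<close> the last letter of \<open>p\<close>;
  these letters differ because \<open>g\<close> is reduced. The number of words \<open>v\<close> grows exponentially in \<open>m\<close>, and this makes
  the multiple as large as desired (\<open>card_changed_words\<close>).

  The rest is formal. A point with finitely many \<open>g\<close> such that \<open>\<omega>\<^sub>g(x) \<ge> 1\<close> has a finite stabilizer, since \<open>\<omega>\<close>
  is multiplicative there and one of \<open>g\<close>, \<open>g\<inverse>\<close> has \<open>\<omega> \<ge> 1\<close>; free groups have no nontrivial finite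
  subgroup, so the action is essentially free. On almost every orbit \<open>\<omega>\<close> attains its maximum at finitely many
  points, and selecting the lexicographically least of these gives a measurable set that meets almost
  every orbit exactly once.
\<close>

section \<open>Reduced words and finite subgroups of free groups\<close>

abbreviation word_inv :: "('a \<times> bool) list \<Rightarrow> ('a \<times> bool) list" where
  "word_inv u \<equiv> rev (map letter_inv u)"

lemma foldr_push_append: "reduced_word (u @ v) \<Longrightarrow> foldr push_letter u v = u @ v"
proof (induction u)
  case (Cons x u)
  then show ?case by (cases "u @ v") (auto simp: reduced_Cons)
qed simp

lemma foldr_push_word_inv: "foldr push_letter u (word_inv u @ v) = v"
  by (induction u arbitrary: v rule: rev_induct) auto

text \<open>
  The cancellation behind all computations in the group: multiplying \<open>p s\<close> by \<open>s\<inverse> v\<close> cancels exactly \<open>s\<close>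
  when no cancellation occurs between \<open>p\<close> and \<open>v\<close>.
\<close>

lemma foldr_push_split:
  assumes "reduced_word (p @ v)"
  shows "foldr push_letter (p @ s) (word_inv s @ v) = p @ v"
  using foldr_push_append[OF assms] by (simp add: foldr_push_word_inv del: rev_map)

lemma reduced_word_append:
  "reduced_word (u @ v) \<longleftrightarrow>
     reduced_word u \<and> reduced_word v \<and> (u = [] \<or> v = [] \<or> hd v \<noteq> letter_inv (last u))"
  by (auto simp: reduced_word_def successively_append_iff)

lemma reduced_word_append_nonempty:
  "c \<noteq> [] \<Longrightarrow> reduced_word (u @ c @ v) \<longleftrightarrow> reduced_word (u @ c) \<and> reduced_word (c @ v)"
  by (auto simp: reduced_word_append)

text \<open>
  Strip the outer letters of \<open>g\<close> as long as they are inverse to each other; a nonempty core remains because \<open>g\<close> is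
  reduced and no letter is its own inverse.
\<close>

lemma cyclically_reduced_conjugate:
  assumes "reduced_word g" "g \<noteq> []"
  shows "\<exists>u c. g = u @ c @ word_inv u \<and> c \<noteq> [] \<and> hd c \<noteq> letter_inv (last c)"
  using assms
proof (induction g rule: length_induct)
  case (1 g)
  show ?case
  proof (cases "hd g = letter_inv (last g)")
    case False
    then show ?thesis using 1 by (intro exI[of _ "[]"] exI[of _ g]) auto
  next
    case True
    obtain x g' where g: "g = x # g'" using 1 by (cases g) auto
    with True have "g' \<noteq> []" by auto
    then obtain g'' y where g': "g' = g'' @ [y]" by (meson rev_exhaust)
    with g True have y: "y = letter_inv x" by (simp add: letter_inv_eq_swap)
    have red: "reduced_word g''"
      using 1(2) by (simp add: g g' reduced_Cons reduced_word_append)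
    have "g'' \<noteq> []" using 1(2) y by (auto simp: g g' reduced_Cons)
    with 1(1)[rule_format, of g''] red obtain u c where
      "g'' = u @ c @ word_inv u" "c \<noteq> []" "hd c \<noteq> letter_inv (last c)"
      unfolding g g' by auto
    then show ?thesis
      by (intro exI[of _ "x # u"] exI[of _ c]) (auto simp: g g' y)
  qed
qed

text \<open>
  With \<open>g = u c u\<inverse>\<close> and \<open>c\<close> cyclically reduced, the word \<open>u c c u\<inverse>\<close> is reduced and represents \<open>g\<^sup>2\<close>.
\<close>

lemma length_square_greater:
  assumes "reduced_word g" "g \<noteq> []"
  shows "length g < length (foldr push_letter g g)"
proof -
  obtain u c where g: "g = u @ c @ word_inv u" and c: "c \<noteq> []" "hd c \<noteq> letter_inv (last c)"
    using cyclically_reduced_conjugate[OF assms] by blast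
  have inv_inv: "word_inv (word_inv u) = u"
    by (simp add: rev_map comp_def)
  have "reduced_word (u @ c)" "reduced_word (c @ word_inv u)"
    using assms(1) c(1) unfolding g by (simp_all add: reduced_word_append_nonempty)
  moreover have "reduced_word (c @ c)"
    using calculation c by (auto simp: reduced_word_append)
  ultimately have red: "reduced_word ((u @ c) @ c @ word_inv u)"
    using c(1) by (simp add: reduced_word_append_nonempty)
  have "foldr push_letter g g = foldr push_letter ((u @ c) @ word_inv u) (word_inv (word_inv u) @ c @ word_inv u)"
    unfolding inv_inv by (simp add: g)
  also have "\<dots> = (u @ c) @ c @ word_inv u"
    by (rule foldr_push_split[OF red])
  finally show ?thesis using c by (simp add: g)
qed

text \<open>
  A longest element of a finite subgroup is empty, since otherwise its square would be longer.
\<close>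

lemma finite_subgroup_free_group:
  assumes "subgroup H free_group" "finite H"
  shows "H = {[]}"
proof (rule ccontr)
  assume ne: "H \<noteq> {[]}"
  interpret subgroup H free_group by fact
  have "[] \<in> H" using one_closed by (simp add: free_group_def)
  obtain w where w: "w \<in> H" "w \<noteq> []" using ne \<open>[] \<in> H\<close> by auto
  have fin: "finite (length ` H)" using assms(2) by simp
  have "Max (length ` H) \<in> length ` H" using fin \<open>[] \<in> H\<close> by (intro Max_in) auto
  then obtain g where g: "g \<in> H" "length g = Max (length ` H)" by auto
  then have max: "length h \<le> length g" if "h \<in> H" for h
    using fin that by simp
  have "g \<noteq> []" using max[OF w(1)] w(2) by auto
  moreover have "reduced_word g" using g(1) subset by (auto simp: free_group_def)
  moreover have "foldr push_letter g g \<in> H"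
    using m_closed[OF g(1) g(1)] by (simp add: free_group_def)
  ultimately show False using length_square_greater[of g] max[of "foldr push_letter g g"] by simp
qed

section \<open>Marginals that read a letter near the end of a word\<close>

text \<open>
  The four letters receive the values \<open>1/4, 5/12, 7/12, 3/4\<close>, any two of which are at least \<open>1/6\<close> apart.
\<close>

definition letter_weight :: "bool \<times> bool \<Rightarrow> real" where
  "letter_weight x = 1/4 + (if fst x then 1/3 else 0) + (if snd x then 1/6 else 0)"

text \<open>
  The function \<open>F\<close> of the construction. Short words have no letter to read; they get the weight of the letter
  \<open>(False, False)\<close>, so that no fifth value arises.
\<close>

definition suffix_marginal :: "nat \<Rightarrow> (bool \<times> bool) list \<Rightarrow> real" where
  "suffix_marginal m h = (if m < length h then letter_weight (rev h ! m) else 1/4)"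

lemma suffix_marginal_bounds: "suffix_marginal m h \<in> {1/4..3/4}"
  by (auto simp: suffix_marginal_def letter_weight_def)

lemma letter_weight_separated: "x \<noteq> y \<Longrightarrow> 1/6 \<le> \<bar>letter_weight x - letter_weight y\<bar>"
  by (cases "fst x"; cases "snd x"; cases "fst y"; cases "snd y")
     (simp_all add: letter_weight_def prod_eq_iff)

lemma suffix_marginal_separated:
  assumes "suffix_marginal m g \<noteq> suffix_marginal m h"
  shows "1/6 \<le> \<bar>suffix_marginal m g - suffix_marginal m h\<bar>"
proof -
  define l where "l w = (if m < length w then rev w ! m else (False, False))" for w
  have "suffix_marginal m w = letter_weight (l w)" for w
    by (simp add: suffix_marginal_def letter_weight_def l_def)
  with assms show ?thesis using letter_weight_separated[of "l g" "l h"] by (cases "l g = l h") auto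
qed

text \<open>
  Pushing a letter adds or removes a letter at the beginning of the word, whereas positions are counted from the end.
\<close>

lemma suffix_marginal_push:
  assumes "Suc m < length h"
  shows "suffix_marginal m (push_letter x h) = suffix_marginal m h"
proof (cases h)
  case (Cons y w)
  have l: "m < length w" using assms Cons by simp
  show ?thesis
  proof (cases "y = letter_inv x")
    case True
    then show ?thesis using l by (simp add: Cons suffix_marginal_def nth_append)
  next
    case False
    then show ?thesis using l by (simp add: Cons suffix_marginal_def nth_append)
  qed
qed (use assms in simp)

lemma length_push: "length h \<le> Suc (length (push_letter x h))"
  by (cases h) auto

lemma length_foldr_push: "length h \<le> length g + length (foldr push_letter g h)"
proof (induction g)
  case (Cons x g)
  then show ?case using length_push[of "foldr push_letter g h" x] by simp
qed simp

lemma suffix_marginal_foldr_push: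
  assumes "length g + m < length h"
  shows "suffix_marginal m (foldr push_letter g h) = suffix_marginal m h"
  using assms
proof (induction g)
  case (Cons x g)
  then have "Suc m < length (foldr push_letter g h)"
    using length_foldr_push[of h g] by simp
  then show ?case using Cons by (simp add: suffix_marginal_push)
qed simp

definition changed_words :: "nat \<Rightarrow> (bool \<times> bool) list \<Rightarrow> (bool \<times> bool) list set" where
  "changed_words m g =
     {h \<in> carrier F2. suffix_marginal m (g \<otimes>\<^bsub>F2\<^esub> h) \<noteq> suffix_marginal m h}"

lemma changed_words_alt:
  "changed_words m g =
     {h. reduced_word h \<and> suffix_marginal m (foldr push_letter g h) \<noteq> suffix_marginal m h}"
  by (simp add: changed_words_def free_group_def)

lemma finite_changed_words: "finite (changed_words m g)"
proof (rule finite_subset)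
  show "changed_words m g \<subseteq> {h. set h \<subseteq> UNIV \<and> length h \<le> length g + m}"
    using suffix_marginal_foldr_push[of g m] by (force simp: changed_words_alt not_less[symmetric])
qed (rule finite_lists_length_le, simp)

lemma suffix_marginal_append:
  assumes "length v = m" "u \<noteq> []"
  shows "suffix_marginal m (u @ v) = letter_weight (last u)"
  using assms by (auto simp: suffix_marginal_def nth_append hd_conv_nth[symmetric] hd_rev)

lemma reduced_word_same_sign: "reduced_word (map (\<lambda>b. (b, s)) bs)"
  by (induction bs) (auto simp: reduced_Cons letter_inv_def hd_map)

text \<open>
  Here \<open>p v\<close> and \<open>s\<inverse> v\<close> are both reduced, so the letters read from them are the last letter of \<open>p\<close> and the inverse of
  the first letter of \<open>s\<close>. They differ because \<open>p s\<close> is reduced.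
\<close>

lemma changed_wordsI:
  assumes red: "reduced_word (p @ s)" and ne: "p \<noteq> []" "s \<noteq> []"
    and v: "reduced_word v" "v \<noteq> []" "length v = m"
    and hd: "hd v \<noteq> hd s" "hd v \<noteq> letter_inv (last p)"
  shows "word_inv s @ v \<in> changed_words m (p @ s)"
proof -
  have p: "reduced_word p" and s: "reduced_word s" and ps: "last p \<noteq> letter_inv (hd s)"
    using red ne by (auto simp: reduced_word_append letter_inv_eq_swap)
  have last_inv: "last (word_inv s) = letter_inv (hd s)"
    using ne by (simp add: last_rev hd_map)
  have "reduced_word (word_inv s @ v)"
    using reduced_inverse[OF s] v hd ne by (subst reduced_word_append) (simp add: last_inv del: rev_map)
  moreover have "foldr push_letter (p @ s) (word_inv s @ v) = p @ v"
    using p v hd by (intro foldr_push_split) (simp add: reduced_word_append)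
  moreover have "suffix_marginal m (p @ v) \<noteq> suffix_marginal m (word_inv s @ v)"
    using letter_weight_separated[OF ps] ne v(3)
    by (auto simp: suffix_marginal_append last_inv simp del: rev_map)
  ultimately show ?thesis
    unfolding changed_words_alt by simp
qed

text \<open>
  Each of the proper splittings of \<open>g\<close> provides \<open>2 ^ k\<close> changed points \<open>s\<inverse> v\<close>: besides the first letter of
  \<open>v\<close>, which has to avoid two letters, its \<open>k\<close> other letters range over the two generators, all with the sign of
  the first one, so that \<open>v\<close> is automatically reduced. Different splittings are told apart by the length of
  \<open>s\<inverse> v\<close>. The factor \<open>2 ^ k\<close> is what later beats the growth of the group.
\<close>

lemma card_changed_words:
  assumes "reduced_word g"
  shows "(length g - 1) * 2 ^ k \<le> card (changed_words (Suc k) g)"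
proof -
  have "\<exists>x. x \<noteq> y \<and> x \<noteq> z" for y z :: "bool \<times> bool"
    by (metis (full_types) prod.inject)
  then have "\<forall>i. \<exists>x. x \<noteq> hd (drop i g) \<and> x \<noteq> letter_inv (last (take i g))"
    by blast
  from choice[OF this] obtain x
    where x: "\<And>i. x i \<noteq> hd (drop i g)" "\<And>i. x i \<noteq> letter_inv (last (take i g))"
    by blast
  define tail where "tail = (\<lambda>i w. map (\<lambda>b. (b, snd (x i))) (fst (x i) # w))"
  define h where "h = (\<lambda>(i, w). word_inv (drop i g) @ tail i w)"
  let ?P = "{1..<length g} \<times> {w :: bool list. set w \<subseteq> UNIV \<and> length w = k}"
  have len: "length (h (i, w)) = length g - i + Suc k" if "(i, w) \<in> ?P" for i w
    using that by (simp add: h_def tail_def)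
  have "inj_on h ?P"
  proof (rule inj_onI)
    fix a b assume ab: "a \<in> ?P" "b \<in> ?P" "h a = h b"
    obtain i w j w' where a: "a = (i, w)" and b: "b = (j, w')"
      by (cases a, cases b)
    have P: "i \<in> {1..<length g}" "j \<in> {1..<length g}" "length w = k" "length w' = k"
      and eq: "h (i, w) = h (j, w')"
      using ab by (auto simp: a b)
    have "length g - i + Suc k = length g - j + Suc k"
      using len[of i w] len[of j w'] P eq by simp
    then have "i = j" using P unfolding atLeastLessThan_iff by linarith
    moreover have "map (\<lambda>b. (b, snd (x i))) w = map (\<lambda>b. (b, snd (x i))) w'"
      using eq \<open>i = j\<close> by (simp add: h_def tail_def)
    then have "w = w'" by (rule map_injective) (simp add: inj_def)
    ultimately show "a = b" by (simp add: a b)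
  qed
  moreover have "h ` ?P \<subseteq> changed_words (Suc k) g"
  proof
    fix z assume "z \<in> h ` ?P"
    then obtain i w where z: "z = h (i, w)" and i: "i \<in> {1..<length g}" and w: "length w = k"
      by auto
    have "word_inv (drop i g) @ tail i w \<in> changed_words (Suc k) (take i g @ drop i g)"
      using i w x[of i] assms reduced_word_same_sign[of "snd (x i)" "fst (x i) # w"]
      by (intro changed_wordsI) (auto simp: tail_def)
    then show "z \<in> changed_words (Suc k) g" by (simp add: z h_def)
  qed
  ultimately have "card ?P \<le> card (changed_words (Suc k) g)"
    using card_inj_on_le finite_changed_words by blast
  also have "card ?P = (length g - 1) * 2 ^ k"
    unfolding card_cartesian_product by (subst card_lists_length_eq) simp_all
  finally show ?thesis .
qed

section \<open>Densities between products of two-point measures\<close>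

definition point_weight :: "real \<Rightarrow> nat \<Rightarrow> real" where
  "point_weight p i = (if i = 0 then p else 1 - p)"

text \<open>
  The Bhattacharyya coefficient (Hellinger affinity) of the two-point measures with parameters \<open>p\<close> and \<open>q\<close>.
\<close>

definition affinity :: "real \<Rightarrow> real \<Rightarrow> real" where
  "affinity p q = sqrt (p * q) + sqrt ((1 - p) * (1 - q))"

lemma affinity_nonneg: "\<lbrakk>0 \<le> p; p \<le> 1; 0 \<le> q; q \<le> 1\<rbrakk> \<Longrightarrow> 0 \<le> affinity p q"
  by (simp add: affinity_def)

text \<open>
  With \<open>a = \<surd>p\<close> and \<open>b = \<surd>q\<close> one has \<open>a b = (p + q - (a - b)\<^sup>2) / 2\<close> and
  \<open>(p - q)\<^sup>2 = (a - b)\<^sup>2 (a + b)\<^sup>2 \<le> 4 (a - b)\<^sup>2\<close>; the second square root is bounded by the arithmetic mean.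
\<close>

lemma affinity_le:
  assumes "0 \<le> p" "p \<le> 1" "0 \<le> q" "q \<le> 1"
  shows "affinity p q \<le> 1 - (p - q)\<^sup>2 / 8"
proof -
  define a b where "a = sqrt p" and "b = sqrt q"
  have ab: "p = a\<^sup>2" "q = b\<^sup>2" "0 \<le> a" "a \<le> 1" "0 \<le> b" "b \<le> 1"
    using assms by (simp_all add: a_def b_def)
  have "(a + b)\<^sup>2 \<le> 2\<^sup>2"
    using ab by (intro power_mono) auto
  then have "(a - b)\<^sup>2 * (a + b)\<^sup>2 \<le> (a - b)\<^sup>2 * 4"
    by (intro mult_left_mono) auto
  moreover have "(p - q)\<^sup>2 = (a - b)\<^sup>2 * (a + b)\<^sup>2"
    unfolding ab by (simp add: power2_eq_square algebra_simps)
  ultimately have "(p - q)\<^sup>2 \<le> 4 * (a - b)\<^sup>2"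
    by simp
  also have "(a - b)\<^sup>2 = p + q - 2 * sqrt (p * q)"
    unfolding ab using ab by (simp add: power2_eq_square algebra_simps real_sqrt_mult)
  finally have "(p - q)\<^sup>2 \<le> 4 * (p + q - 2 * sqrt (p * q))" .
  moreover have "sqrt ((1 - p) * (1 - q)) \<le> ((1 - p) + (1 - q)) / 2"
    using assms by (intro arith_geo_mean_sqrt) auto
  ultimately show ?thesis unfolding affinity_def by (simp add: field_simps)
qed

lemma sets_two_point_measure: "sets (two_point_measure p) = Pow {0, 1}"
  by (simp add: two_point_measure_def sets_point_measure)

lemma space_two_point_measure: "space (two_point_measure p) = {0, 1}"
  by (simp add: two_point_measure_def space_point_measure)

lemma borel_measurable_two_point_measure [measurable]:
  "f \<in> borel_measurable (two_point_measure p)"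
  by (simp add: two_point_measure_def)

lemma nn_integral_two_point_measure:
  "(\<integral>\<^sup>+i. f i \<partial>two_point_measure p) = ennreal p * f 0 + ennreal (1 - p) * f 1"
  unfolding two_point_measure_def
  by (simp add: nn_integral_point_measure_finite mult.commute)

lemma emeasure_two_point_measure_eq:
  assumes "A \<subseteq> {0, 1}"
  shows "emeasure (two_point_measure p) A =
    ennreal p * indicator A 0 + ennreal (1 - p) * indicator A 1"
  using nn_integral_two_point_measure[where f = "indicator A" and p = p] assms
  by (simp add: sets_two_point_measure)

locale two_point_product =
  fixes I :: "'i set" and F :: "'i \<Rightarrow> real"
  assumes F_pos: "\<And>i. 0 < F i" and F_less: "\<And>i. F i < 1"
begin

definition P :: "('i \<Rightarrow> nat) measure" where
  "P = (\<Pi>\<^sub>M i\<in>I. two_point_measure (F i))"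

sublocale product_prob_space "\<lambda>i. two_point_measure (F i)" I
proof -
  have "prob_space (two_point_measure (F i))" for i
    using F_pos[of i] F_less[of i] by (intro prob_space_two_point_measure) auto
  then show "product_prob_space (\<lambda>i. two_point_measure (F i))"
    by (intro product_prob_spaceI)
qed

lemma space_P: "space P = I \<rightarrow>\<^sub>E {0, 1}"
  by (simp add: P_def space_PiM space_two_point_measure)

text \<open>
  This also covers indices outside \<open>I\<close>, where configurations have the constant value \<open>undefined\<close>.
\<close>

lemma measurable_coordinate [measurable]: "(\<lambda>x. f (x i)) \<in> measurable P (count_space UNIV)"
proof (cases "i \<in> I")
  case True
  have "(\<lambda>x. x i) \<in> measurable P (two_point_measure (F i))"
    unfolding P_def using True by (rule measurable_component_singleton)
  moreover have "f \<in> measurable (two_point_measure (F i)) (count_space UNIV)"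
    by (simp add: two_point_measure_def)
  ultimately show ?thesis by (rule measurable_compose)
next
  case False
  have "(\<lambda>x. f (x i)) \<in> measurable P (count_space UNIV) \<longleftrightarrow>
      (\<lambda>x. f undefined) \<in> measurable P (count_space UNIV)"
    using False by (intro measurable_cong) (auto simp: space_P PiE_def extensional_def)
  then show ?thesis by simp
qed

lemma borel_measurable_coordinate [measurable]: "(\<lambda>x. f (x i)) \<in> borel_measurable P"
  by (rule measurable_compose[OF measurable_coordinate[of "\<lambda>x. x"]]) simp

text \<open>
  Independence of the coordinates, obtained by projecting the infinite product to the finite product over \<open>K\<close>.
\<close>

lemma nn_integral_prod_coordinates:
  assumes "finite K" "K \<subseteq> I"
  shows "(\<integral>\<^sup>+x. (\<Prod>i\<in>K. f i (x i)) \<partial>P) = (\<Prod>i\<in>K. \<integral>\<^sup>+a. f i a \<partial>two_point_measure (F i))"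
proof -
  let ?M = "\<lambda>i. two_point_measure (F i)"
  have meas: "(\<lambda>x. f i (x i)) \<in> borel_measurable (Pi\<^sub>M K ?M)" if "i \<in> K" for i
    by (rule measurable_compose[OF measurable_component_singleton[OF that]])
       (rule borel_measurable_two_point_measure)
  have "(\<Prod>i\<in>K. \<integral>\<^sup>+a. f i a \<partial>?M i) = (\<integral>\<^sup>+x. (\<Prod>i\<in>K. f i (x i)) \<partial>Pi\<^sub>M K ?M)"
    using assms by (intro product_nn_integral_prod[symmetric]) auto
  also have "Pi\<^sub>M K ?M = distr (Pi\<^sub>M I ?M) (Pi\<^sub>M K ?M) (\<lambda>x. restrict x K)"
    using distr_PiM_restrict_finite[OF assms] by simp
  also have "(\<integral>\<^sup>+x. (\<Prod>i\<in>K. f i (x i)) \<partial>\<dots>) = (\<integral>\<^sup>+x. (\<Prod>i\<in>K. f i (restrict x K i)) \<partial>Pi\<^sub>M I ?M)"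
    using assms meas
    by (intro nn_integral_distr borel_measurable_prod_ennreal measurable_restrict_subset) auto
  also have "\<dots> = (\<integral>\<^sup>+x. (\<Prod>i\<in>K. f i (x i)) \<partial>P)"
    by (simp add: P_def)
  finally show ?thesis ..
qed

text \<open>
  The likelihood ratio of the product measure with marginals \<open>F'\<close> against the one with marginals \<open>F\<close>; it is
  meaningful when only finitely many marginals differ.
\<close>

definition likelihood :: "('i \<Rightarrow> real) \<Rightarrow> ('i \<Rightarrow> nat) \<Rightarrow> real" where
  "likelihood F' x =
     (\<Prod>i\<in>{i\<in>I. F' i \<noteq> F i}. point_weight (F' i) (x i) / point_weight (F i) (x i))"

lemma point_weight_pos: "0 < point_weight (F i) a"
  using F_pos[of i] F_less[of i] by (simp add: point_weight_def)

lemma likelihood_superset: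
  assumes "finite K" "{i\<in>I. F' i \<noteq> F i} \<subseteq> K" "K \<subseteq> I"
  shows "likelihood F' x = (\<Prod>i\<in>K. point_weight (F' i) (x i) / point_weight (F i) (x i))"
  unfolding likelihood_def using assms point_weight_pos
  by (intro prod.mono_neutral_left) (auto simp: less_imp_neq[symmetric])

lemma borel_measurable_likelihood [measurable]: "likelihood F' \<in> borel_measurable P"
  unfolding likelihood_def by measurable

lemma likelihood_pos:
  assumes "\<And>i. 0 < F' i" "\<And>i. F' i < 1"
  shows "0 < likelihood F' x"
  unfolding likelihood_def using assms F_pos F_less
  by (intro prod_pos) (auto simp: point_weight_def)

text \<open>
  Both measures agree on cylinder sets: on a cylinder over \<open>J\<close> the density integrates to a product over the
  finite set of the indices in \<open>J\<close> and the changed ones, and each factor is the mass under the new marginal.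
\<close>

lemma density_likelihood:
  assumes F': "\<And>i. 0 < F' i" "\<And>i. F' i < 1" and fin: "finite {i\<in>I. F' i \<noteq> F i}"
  shows "(\<Pi>\<^sub>M i\<in>I. two_point_measure (F' i)) = density P (\<lambda>x. ennreal (likelihood F' x))"
    (is "?P' = _")
proof (rule measure_eqI_PiM_infinite[where M = "\<lambda>i. two_point_measure (F' i)"])
  interpret F': two_point_product I F'
    using F' by unfold_locales
  show "sets (density P (\<lambda>x. ennreal (likelihood F' x))) = sets ?P'"
    by (auto simp: P_def sets_two_point_measure intro!: sets_PiM_cong)
  show "finite_measure ?P'"
    using F'.P.finite_measure_axioms by simp
  fix A J assume J: "finite J" "J \<subseteq> I" and A: "\<And>i. i \<in> J \<Longrightarrow> A i \<in> sets (two_point_measure (F' i))"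
  let ?E = "prod_emb I (\<lambda>i. two_point_measure (F' i)) J (Pi\<^sub>E J A)"
  define K where "K = J \<union> {i\<in>I. F' i \<noteq> F i}"
  have K: "finite K" "{i\<in>I. F' i \<noteq> F i} \<subseteq> K" "K \<subseteq> I" "J \<subseteq> K"
    using J fin by (auto simp: K_def)
  define B where "B i = (if i \<in> J then A i else {0, 1})" for i
  have B: "B i \<subseteq> {0, 1}" for i
    using A[of i] by (auto simp: B_def sets_two_point_measure)
  define r where "r i a = ennreal (point_weight (F' i) a / point_weight (F i) a)" for i a
  have E: "?E \<in> sets P"
  proof -
    have "?E \<in> sets ?P'" using J A by (intro sets_PiM_I) auto
    also have "sets ?P' = sets P" by (auto simp: P_def sets_two_point_measure intro!: sets_PiM_cong)
    finally show ?thesis .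
  qed
  have "(\<integral>\<^sup>+a. r i a * indicator (B i) a \<partial>two_point_measure (F i)) =
      emeasure (two_point_measure (F' i)) (B i)" for i
    unfolding nn_integral_two_point_measure emeasure_two_point_measure_eq[OF B]
    using F_pos[of i] F_less[of i] F'[of i]
    by (simp add: r_def point_weight_def mult.assoc[symmetric] ennreal_mult'[symmetric])
  then have "(\<Prod>i\<in>K. emeasure (two_point_measure (F' i)) (B i)) =
      (\<Prod>i\<in>K. \<integral>\<^sup>+a. r i a * indicator (B i) a \<partial>two_point_measure (F i))"
    by simp
  also have "\<dots> = (\<integral>\<^sup>+x. (\<Prod>i\<in>K. r i (x i) * indicator (B i) (x i)) \<partial>P)"
    by (rule nn_integral_prod_coordinates[OF K(1,3), symmetric])
  also have "\<dots> = (\<integral>\<^sup>+x. ennreal (likelihood F' x) * indicator ?E x \<partial>P)"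
  proof (rule nn_integral_cong)
    fix x assume x: "x \<in> space P"
    have "(\<Prod>i\<in>K. indicator (B i) (x i)) = (indicator ?E x :: ennreal)"
    proof (cases "x \<in> ?E")
      case True
      then have "x i \<in> B i" if "i \<in> K" for i
        using x K that by (auto simp: prod_emb_def B_def space_P PiE_iff)
      with True show ?thesis by simp
    next
      case False
      then obtain i where "i \<in> J" "x i \<notin> A i"
        using x by (auto simp: prod_emb_def space_P space_two_point_measure PiE_iff)
      then have "i \<in> K" "indicator (B i) (x i) = (0::ennreal)"
        using K by (auto simp: B_def)
      then have "(\<Prod>i\<in>K. indicator (B i) (x i)) = (0::ennreal)"
        using K(1) by (intro prod_zero) auto
      with False show ?thesis by simp
    qed
    moreover have "ennreal (likelihood F' x) = (\<Prod>i\<in>K. r i (x i))"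
      unfolding likelihood_superset[OF K(1-3)] r_def
      using point_weight_pos F'.point_weight_pos
      by (intro prod_ennreal[symmetric]) (auto intro!: divide_nonneg_nonneg less_imp_le)
    ultimately show "(\<Prod>i\<in>K. r i (x i) * indicator (B i) (x i)) =
        ennreal (likelihood F' x) * indicator ?E x"
      by (simp add: prod.distrib)
  qed
  also have "\<dots> = emeasure (density P (\<lambda>x. ennreal (likelihood F' x))) ?E"
    using E by (intro emeasure_density[symmetric]) auto
  finally have "emeasure (density P (\<lambda>x. ennreal (likelihood F' x))) ?E =
      (\<Prod>i\<in>K. emeasure (two_point_measure (F' i)) (B i))" ..
  also have "\<dots> = (\<Prod>i\<in>J. emeasure (two_point_measure (F' i)) (A i))"
    using K F'.M.emeasure_space_1
    by (intro prod.mono_neutral_cong_right) (auto simp: B_def space_two_point_measure)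
  also have "\<dots> = emeasure ?P' ?E"
    using J A by (intro F'.emeasure_PiM_emb[symmetric]) auto
  finally show "emeasure ?P' ?E = emeasure (density P (\<lambda>x. ennreal (likelihood F' x))) ?E" ..
qed simp_all

lemma nn_integral_sqrt_likelihood:
  assumes F': "\<And>i. 0 < F' i" "\<And>i. F' i < 1" and fin: "finite {i\<in>I. F' i \<noteq> F i}"
  shows "(\<integral>\<^sup>+x. ennreal (sqrt (likelihood F' x)) \<partial>P) =
    ennreal (\<Prod>i\<in>{i\<in>I. F' i \<noteq> F i}. affinity (F i) (F' i))"
proof -
  let ?D = "{i\<in>I. F' i \<noteq> F i}"
  interpret F': two_point_product I F'
    using F' by unfold_locales
  have root: "sqrt (\<Prod>i\<in>D. f i) = (\<Prod>i\<in>D. sqrt (f i))" for f and D :: "'i set"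
    by (induction D rule: infinite_finite_induct) (simp_all add: real_sqrt_mult)
  have "(\<integral>\<^sup>+x. ennreal (sqrt (likelihood F' x)) \<partial>P) =
      (\<integral>\<^sup>+x. (\<Prod>i\<in>?D. ennreal (sqrt (point_weight (F' i) (x i) / point_weight (F i) (x i)))) \<partial>P)"
    unfolding likelihood_def root
    using point_weight_pos F'.point_weight_pos
    by (intro nn_integral_cong prod_ennreal[symmetric])
       (auto intro!: divide_nonneg_nonneg less_imp_le)
  also have "\<dots> = (\<Prod>i\<in>?D. \<integral>\<^sup>+a. ennreal (sqrt (point_weight (F' i) a / point_weight (F i) a))
      \<partial>two_point_measure (F i))"
    using fin by (intro nn_integral_prod_coordinates) auto
  also have "\<dots> = (\<Prod>i\<in>?D. ennreal (affinity (F i) (F' i)))"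
  proof (intro prod.cong refl)
    fix i
    have root: "p * sqrt (q / p) = sqrt (p * q)" if "0 < p" for p q :: real
      using that by (simp add: real_sqrt_divide real_sqrt_mult field_simps)
    show "(\<integral>\<^sup>+a. ennreal (sqrt (point_weight (F' i) a / point_weight (F i) a))
        \<partial>two_point_measure (F i)) = ennreal (affinity (F i) (F' i))"
      using F_pos[of i] F_less[of i] F'[of i]
      by (simp add: nn_integral_two_point_measure point_weight_def affinity_def
          ennreal_mult'[symmetric] root)
  qed
  also have "\<dots> = ennreal (\<Prod>i\<in>?D. affinity (F i) (F' i))"
    using F_pos F_less F' by (intro prod_ennreal affinity_nonneg) (auto intro: less_imp_le)
  finally show ?thesis .
qed

text \<open>
  Markov's inequality for the square root of the likelihood ratio, whose expectation is a product of affinities.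
  The likelihood ratio itself has expectation \<open>1\<close> and would give nothing.
\<close>

lemma prob_likelihood_ge_1:
  assumes F': "\<And>i. 0 < F' i" "\<And>i. F' i < 1" and fin: "finite {i\<in>I. F' i \<noteq> F i}"
    and aff: "\<And>i. \<lbrakk>i \<in> I; F' i \<noteq> F i\<rbrakk> \<Longrightarrow> affinity (F i) (F' i) \<le> \<rho>"
  shows "measure P {x \<in> space P. 1 \<le> likelihood F' x} \<le> \<rho> ^ card {i\<in>I. F' i \<noteq> F i}"
proof -
  let ?D = "{i\<in>I. F' i \<noteq> F i}"
  have aff_nn: "0 \<le> affinity (F i) (F' i)" for i
    using F_pos F_less F' by (intro affinity_nonneg) (auto intro: less_imp_le)
  have "emeasure P {x \<in> space P. 1 \<le> likelihood F' x} = (\<integral>\<^sup>+x. indicator {x \<in> space P. 1 \<le> likelihood F' x} x \<partial>P)"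
    by (intro nn_integral_indicator[symmetric]) measurable
  also have "\<dots> \<le> (\<integral>\<^sup>+x. ennreal (sqrt (likelihood F' x)) \<partial>P)"
    using likelihood_pos[OF F'] by (intro nn_integral_mono) (auto split: split_indicator)
  also have "\<dots> = ennreal (\<Prod>i\<in>?D. affinity (F i) (F' i))"
    by (rule nn_integral_sqrt_likelihood[OF F' fin])
  finally have "measure P {x \<in> space P. 1 \<le> likelihood F' x} \<le> (\<Prod>i\<in>?D. affinity (F i) (F' i))"
    unfolding measure_def using aff_nn by (intro enn2real_leI prod_nonneg) auto
  also have "\<dots> \<le> (\<Prod>i\<in>?D. \<rho>)"
    using aff aff_nn by (intro prod_mono) auto
  finally show ?thesis by simp
qed

end

section \<open>Cocycles with finite superlevel sets\<close>

text \<open>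
  The values \<open>\<omega> g x\<close> play the role of the Radon-Nikodym derivatives of the action. The cocycle identity is
  required at every point, which avoids null sets in the orbitwise arguments below.
\<close>

locale finite_level_cocycle = group_action G "space M" \<phi>
  for G :: "('g, 'c) monoid_scheme" (structure) and M :: "'x measure" and \<phi> :: "'g \<Rightarrow> 'x \<Rightarrow> 'x" +
  fixes \<omega> :: "'g \<Rightarrow> 'x \<Rightarrow> real"
  assumes cocycle_pos: "\<lbrakk>g \<in> carrier G; x \<in> space M\<rbrakk> \<Longrightarrow> 0 < \<omega> g x"
    and cocycle: "\<lbrakk>g \<in> carrier G; h \<in> carrier G; x \<in> space M\<rbrakk> \<Longrightarrow> \<omega> (g \<otimes> h) x = \<omega> g (\<phi> h x) * \<omega> h x"
    and finite_superlevel: "AE x in M. finite {g \<in> carrier G. 1 \<le> \<omega> g x}"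
begin

sublocale G: group G
  using group_hom group_hom.axioms(1) by auto

lemma act_one: "x \<in> space M \<Longrightarrow> \<phi> \<one> x = x"
  using id_eq_one by (metis restrict_apply')

lemma act_in_space: "\<lbrakk>g \<in> carrier G; x \<in> space M\<rbrakk> \<Longrightarrow> \<phi> g x \<in> space M"
  using element_image by blast

lemma cocycle_one: "x \<in> space M \<Longrightarrow> \<omega> \<one> x = 1"
  using cocycle[of \<one> \<one> x] cocycle_pos[of \<one> x] by (simp add: act_one)

lemma cocycle_inv:
  "\<lbrakk>g \<in> carrier G; x \<in> space M\<rbrakk> \<Longrightarrow> \<omega> (inv g) (\<phi> g x) * \<omega> g x = 1"
  using cocycle[of "inv g" g x] by (simp add: cocycle_one)

text \<open>
  For \<open>g\<close> in the stabilizer of \<open>x\<close> the numbers \<open>\<omega> g x\<close> and \<open>\<omega> g\<inverse> x\<close> are inverse to each other, so one of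
  them is at least \<open>1\<close>.
\<close>

lemma finite_stabilizer:
  assumes x: "x \<in> space M" and fin: "finite {g \<in> carrier G. 1 \<le> \<omega> g x}"
  shows "finite (stabilizer G \<phi> x)"
proof (rule finite_subset)
  let ?L = "{g \<in> carrier G. 1 \<le> \<omega> g x}"
  show "stabilizer G \<phi> x \<subseteq> ?L \<union> (\<lambda>g. inv g) ` ?L"
  proof
    fix g assume "g \<in> stabilizer G \<phi> x"
    then have g: "g \<in> carrier G" "\<phi> g x = x" by (auto simp: stabilizer_def)
    have "\<omega> (inv g) x * \<omega> g x = 1" using cocycle_inv[OF g(1) x] g(2) by simp
    moreover have "\<omega> (inv g) x * \<omega> g x < 1 * 1" if "\<omega> (inv g) x < 1" "\<omega> g x < 1"
      using that cocycle_pos[OF g(1) x] by (intro mult_strict_mono) auto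
    ultimately have "1 \<le> \<omega> g x \<or> 1 \<le> \<omega> (inv g) x" by force
    then show "g \<in> ?L \<union> (\<lambda>g. inv g) ` ?L"
    proof
      assume "1 \<le> \<omega> (inv g) x"
      then have "inv (inv g) \<in> (\<lambda>g. inv g) ` ?L" using g(1) by blast
      then show ?thesis using g(1) by simp
    qed (use g in simp)
  qed
  show "finite (?L \<union> (\<lambda>g. inv g) ` ?L)" using fin by simp
qed

lemma essentially_free_if_no_finite_subgroup:
  assumes "\<And>H. \<lbrakk>subgroup H G; finite H\<rbrakk> \<Longrightarrow> H = {\<one>}"
  shows "essentially_free G M \<phi>"
  unfolding essentially_free_def
  using finite_superlevel AE_space
proof eventually_elim
  case (elim x)
  then show ?case using assms stabilizer_subgroup finite_stabilizer by blast
qed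

text \<open>
  The points at which the orbit's density is maximal, where ties are broken by the order \<open>R\<close>. By the cocycle
  identity, \<open>\<omega> g x\<close> compares the density at \<open>\<phi> g x\<close> with the one at \<open>x\<close>.
\<close>

definition peaks :: "('x \<Rightarrow> 'x \<Rightarrow> bool) \<Rightarrow> 'x set" where
  "peaks R = {x \<in> space M. \<forall>g \<in> carrier G - {\<one>}. \<omega> g x < 1 \<or> \<omega> g x = 1 \<and> R x (\<phi> g x)}"

text \<open>
  If two translates met, two points \<open>x\<close> and \<open>y = \<phi> k x\<close> of one orbit would both be peaks: each has density at
  least that of the other, so the densities agree and \<open>R\<close> would hold in both directions.
\<close>

lemma peaks_disjoint:
  assumes R: "asymp R" and gh: "g \<in> carrier G" "h \<in> carrier G" "g \<noteq> h"
  shows "\<phi> g ` peaks R \<inter> \<phi> h ` peaks R = {}"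
proof (rule ccontr)
  assume "\<phi> g ` peaks R \<inter> \<phi> h ` peaks R \<noteq> {}"
  then obtain x y where x: "x \<in> peaks R" and y: "y \<in> peaks R" and eq: "\<phi> g x = \<phi> h y" by auto
  have sp: "x \<in> space M" "y \<in> space M" using x y by (auto simp: peaks_def)
  define k where "k = inv h \<otimes> g"
  have k: "k \<in> carrier G" using gh by (simp add: k_def)
  have "\<phi> k x = \<phi> (inv h) (\<phi> h y)"
    using gh sp by (simp add: k_def composition_rule eq)
  then have kx: "\<phi> k x = y" using gh sp orbit_sym_aux[of h y] by simp
  have ky: "\<phi> (inv k) y = x" using k sp kx orbit_sym_aux[of k x] by simp
  have k1: "k \<noteq> \<one>"
  proof
    assume "k = \<one>"
    then have "inv (inv h) = g" using gh by (intro G.inv_equality[of g]) (auto simp: k_def G.inv_comm)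
    then show False using gh by simp
  qed
  then have "inv k \<noteq> \<one>" using k by (simp add: G.inv_eq_1_iff)
  have "\<omega> (inv k) y * \<omega> k x = 1" using cocycle_inv[OF k sp(1)] kx by simp
  moreover have "\<omega> k x < 1 \<or> \<omega> k x = 1 \<and> R x y"
    using x k k1 kx by (auto simp: peaks_def)
  moreover have "\<omega> (inv k) y < 1 \<or> \<omega> (inv k) y = 1 \<and> R y x"
    using y k \<open>inv k \<noteq> \<one>\<close> ky by (auto simp: peaks_def)
  ultimately have "R x y" "R y x"
    using mult_strict_mono[of "\<omega> (inv k) y" 1 "\<omega> k x" 1] cocycle_pos[OF k sp(1)] by auto
  then show False using R by (meson asympD)
qed

text \<open>
  Finiteness of the superlevel set makes the maximum of \<open>\<omega> g x\<close> over \<open>g\<close> exist and be attained finitely often;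
  \<open>R\<close> selects one of the maximizing points. Freeness is needed since \<open>\<phi> h\<close> must move this point for \<open>h \<noteq> \<one>\<close>.
\<close>

lemma orbit_meets_peaks:
  assumes R: "asymp R" "transp R" "totalp R" and x: "x \<in> space M"
    and fin: "finite {g \<in> carrier G. 1 \<le> \<omega> g x}" and free: "stabilizer G \<phi> x = {\<one>}"
  shows "\<exists>g\<in>carrier G. \<phi> g x \<in> peaks R"
proof -
  let ?L = "{g \<in> carrier G. 1 \<le> \<omega> g x}"
  have L: "\<one> \<in> ?L" using x by (simp add: cocycle_one)
  define m where "m = Max ((\<lambda>g. \<omega> g x) ` ?L)"
  have m: "\<omega> g x \<le> m" if "g \<in> carrier G" for g
  proof (cases "1 \<le> \<omega> g x")
    case True
    then show ?thesis using that fin by (auto simp: m_def intro!: Max_ge)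
  next
    case False
    have "\<omega> \<one> x \<le> m" unfolding m_def using L fin by (intro Max_ge) auto
    with False show ?thesis using cocycle_one[OF x] by simp
  qed
  have "m \<in> (\<lambda>g. \<omega> g x) ` ?L" unfolding m_def using L fin by (intro Max_in) auto
  then have A: "{g \<in> ?L. \<omega> g x = m} \<noteq> {}" by auto
  have finA: "finite {g \<in> ?L. \<omega> g x = m}" by (rule finite_subset[OF _ fin]) auto
  let ?B = "(\<lambda>g. \<phi> g x) ` {g \<in> ?L. \<omega> g x = m}"
  have "\<exists>l\<in>?B. \<forall>y\<in>?B. y \<noteq> l \<longrightarrow> R l y"
    using finA A R by (intro Finite_Set.bex_least_element) (auto intro: asymp_on_subset transp_on_subset totalp_on_subset)
  then obtain g where g: "g \<in> carrier G" "\<omega> g x = m" and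
    least: "\<And>h. \<lbrakk>h \<in> carrier G; 1 \<le> \<omega> h x; \<omega> h x = m; \<phi> h x \<noteq> \<phi> g x\<rbrakk> \<Longrightarrow> R (\<phi> g x) (\<phi> h x)"
    by auto
  have "1 \<le> m" using m[of \<one>] cocycle_one[OF x] by simp
  have "\<phi> g x \<in> peaks R"
    unfolding peaks_def
  proof (intro CollectI conjI ballI)
    show "\<phi> g x \<in> space M" using g x by (simp add: act_in_space)
    fix h assume "h \<in> carrier G - {\<one>}"
    then have h: "h \<in> carrier G" "h \<noteq> \<one>" by auto
    have eq: "\<omega> (h \<otimes> g) x = \<omega> h (\<phi> g x) * m" "\<phi> (h \<otimes> g) x = \<phi> h (\<phi> g x)"
      using cocycle[OF h(1) g(1) x] composition_rule[OF x h(1) g(1)] g(2) by simp_all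
    have "\<omega> h (\<phi> g x) * m \<le> 1 * m" using m[of "h \<otimes> g"] h g by (simp add: eq)
    then have le: "\<omega> h (\<phi> g x) \<le> 1" using \<open>1 \<le> m\<close> by (subst (asm) mult_le_cancel_right) auto
    show "\<omega> h (\<phi> g x) < 1 \<or> \<omega> h (\<phi> g x) = 1 \<and> R (\<phi> g x) (\<phi> h (\<phi> g x))"
    proof (cases "\<omega> h (\<phi> g x) = 1")
      case True
      have "\<phi> (h \<otimes> g) x \<noteq> \<phi> g x"
      proof
        assume "\<phi> (h \<otimes> g) x = \<phi> g x"
        then have "\<phi> (inv g \<otimes> (h \<otimes> g)) x = x"
          using composition_rule[OF x, of "inv g" "h \<otimes> g"] orbit_sym_aux[OF g(1) x refl] g h by simp
        then have "inv g \<otimes> (h \<otimes> g) \<in> stabilizer G \<phi> x" using g h by (simp add: stabilizer_def)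
        then have "inv g \<otimes> (h \<otimes> g) = \<one>" using free by simp
        then have "g \<otimes> (inv g \<otimes> (h \<otimes> g)) = g" using g by simp
        then have "h \<otimes> g = g" using g h by (simp add: G.m_assoc[symmetric])
        then show False using g h by simp
      qed
      then show ?thesis
        using least[of "h \<otimes> g"] g h True \<open>1 \<le> m\<close> by (simp add: eq)
    qed (use le in simp)
  qed
  then show ?thesis using g(1) by blast
qed

lemma dissipative_if_essentially_free:
  assumes free: "essentially_free G M \<phi>" and R: "asymp R" "transp R" "totalp R"
    and count: "countable (carrier G)"
    and meas: "\<And>g. g \<in> carrier G \<Longrightarrow> \<omega> g \<in> borel_measurable M"
      "\<And>g. g \<in> carrier G \<Longrightarrow> {x \<in> space M. R x (\<phi> g x)} \<in> sets M"
  shows "dissipative G M \<phi>"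
  unfolding dissipative_def
proof (intro bexI conjI)
  show "disjoint_family_on (\<lambda>g. \<phi> g ` peaks R) (carrier G)"
    using peaks_disjoint[OF R(1)] by (auto simp: disjoint_family_on_def)
  show "AE x in M. x \<in> (\<Union>g\<in>carrier G. \<phi> g ` peaks R)"
    using free[unfolded essentially_free_def] finite_superlevel AE_space
  proof eventually_elim
    case (elim x)
    then obtain g where g: "g \<in> carrier G" "\<phi> g x \<in> peaks R"
      using orbit_meets_peaks[OF R, of x] by blast
    moreover have "\<phi> (inv g) (\<phi> g x) = x" using orbit_sym_aux[OF g(1) elim(3) refl] .
    ultimately have "inv g \<in> carrier G" "x \<in> \<phi> (inv g) ` peaks R" by force+
    then show ?case by blast
  qed
  have piece: "{x \<in> space M. \<omega> g x < 1 \<or> \<omega> g x = 1 \<and> R x (\<phi> g x)} \<in> sets M"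
    if "g \<in> carrier G" for g
  proof -
    note [measurable] = meas(1)[OF that]
    have "{x \<in> space M. \<omega> g x < 1} \<in> sets M" "{x \<in> space M. \<omega> g x = 1} \<in> sets M"
      by measurable
    then show ?thesis
      using meas(2)[OF that] by (intro sets.sets_Collect_disj sets.sets_Collect_conj)
  qed
  show "peaks R \<in> sets M"
    unfolding peaks_def
  proof (rule sets.sets_Collect_countable_All')
    show "countable (carrier G - {\<one>})" using count by (rule countable_Diff)
  qed (use piece in blast)
qed

end

section \<open>A measurable linear order on configurations\<close>

lemma totalp_less_fun: "totalp (less_fun :: (nat \<Rightarrow> 'a::linorder) \<Rightarrow> _)"
proof (rule totalpI)
  fix f g :: "nat \<Rightarrow> 'a" assume "f \<noteq> g"
  then have ex: "\<exists>n. f n \<noteq> g n" by auto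
  define n where "n = (LEAST n. f n \<noteq> g n)"
  have neq: "f n \<noteq> g n"
    unfolding n_def by (rule LeastI_ex[OF ex])
  have eq: "f k = g k" if "k < n" for k
    using not_less_Least[OF that[unfolded n_def]] by simp
  show "less_fun f g \<or> less_fun g f"
  proof (cases "f n < g n")
    case True
    then have "less_fun f g" using eq by (intro less_funI exI[of _ n]) simp
    then show ?thesis ..
  next
    case False
    then have "g n < f n" using neq by simp
    then have "less_fun g f" using eq by (intro less_funI exI[of _ n]) simp
    then show ?thesis ..
  qed
qed

text \<open>
  Lexicographic comparison along an enumeration of the index type.
\<close>

definition less_config :: "('a::countable \<Rightarrow> nat) \<Rightarrow> ('a \<Rightarrow> nat) \<Rightarrow> bool" where
  "less_config x y = less_fun (x \<circ> from_nat) (y \<circ> from_nat)"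

lemma less_config_order:
  shows "asymp (less_config :: ('a::countable \<Rightarrow> nat) \<Rightarrow> _)"
    and "transp (less_config :: ('a \<Rightarrow> nat) \<Rightarrow> _)"
    and "totalp (less_config :: ('a \<Rightarrow> nat) \<Rightarrow> _)"
proof -
  show "asymp (less_config :: ('a \<Rightarrow> nat) \<Rightarrow> _)"
    by (rule asympI) (auto simp: less_config_def dest: less_fun_asym)
  show "transp (less_config :: ('a \<Rightarrow> nat) \<Rightarrow> _)"
    by (rule transpI) (auto simp: less_config_def intro: less_fun_trans)
  have inj: "x = y" if "x \<circ> from_nat = y \<circ> from_nat" for x y :: "'a \<Rightarrow> nat"
    using that by (metis comp_apply ext from_nat_to_nat)
  show "totalp (less_config :: ('a \<Rightarrow> nat) \<Rightarrow> _)"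
  proof (rule totalpI)
    fix x y :: "'a \<Rightarrow> nat" assume "x \<noteq> y"
    then have "x \<circ> from_nat \<noteq> y \<circ> from_nat" using inj by blast
    then show "less_config x y \<or> less_config y x"
      unfolding less_config_def by (rule totalpD[OF totalp_less_fun])
  qed
qed

section \<open>Bernoulli actions with finitely many changed marginals\<close>

locale finite_shift_bernoulli = two_point_product "carrier G" F + group G
  for G :: "('g :: countable, 'c) monoid_scheme" (structure) and F :: "'g \<Rightarrow> real" +
  assumes finite_changed: "g \<in> carrier G \<Longrightarrow> finite {h \<in> carrier G. F (g \<otimes> h) \<noteq> F h}"
begin

lemma bernoulli_space_eq: "bernoulli_space G F = P"
  by (simp add: bernoulli_space_def P_def)

lemma bernoulli_group_action: "group_action G (space P) (bernoulli_action G)"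
  using group_action_bernoulli[OF group_axioms, of F] by (simp add: bernoulli_space_eq)

lemma bernoulli_action_apply:
  "\<lbrakk>x \<in> space P; h \<in> carrier G\<rbrakk> \<Longrightarrow> bernoulli_action G g x h = x (inv g \<otimes> h)"
  by (simp add: bernoulli_action_def space_P)

lemma measurable_bernoulli_action [measurable]:
  assumes g: "g \<in> carrier G"
  shows "bernoulli_action G g \<in> measurable P P"
proof -
  have "(\<lambda>x. \<lambda>h\<in>carrier G. x (inv g \<otimes> h)) \<in>
      measurable P (\<Pi>\<^sub>M h\<in>carrier G. two_point_measure (F h))"
  proof (rule measurable_restrict)
    fix h assume "h \<in> carrier G"
    then have "(\<lambda>x. x (inv g \<otimes> h)) \<in> measurable P (two_point_measure (F (inv g \<otimes> h)))"
      unfolding P_def using g by (intro measurable_component_singleton) auto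
    then show "(\<lambda>x. x (inv g \<otimes> h)) \<in> measurable P (two_point_measure (F h))"
      by (subst measurable_cong_sets[where M' = P and N' = "two_point_measure (F (inv g \<otimes> h))"])
         (simp_all add: sets_two_point_measure)
  qed
  then have "(\<lambda>x. \<lambda>h\<in>carrier G. x (inv g \<otimes> h)) \<in> measurable P P"
    by (simp add: P_def[symmetric])
  moreover have "bernoulli_action G g \<in> measurable P P \<longleftrightarrow>
      (\<lambda>x. \<lambda>h\<in>carrier G. x (inv g \<otimes> h)) \<in> measurable P P"
    by (intro measurable_cong) (simp add: bernoulli_action_def space_P)
  ultimately show ?thesis by simp
qed

definition shift_likelihood :: "'g \<Rightarrow> ('g \<Rightarrow> nat) \<Rightarrow> real" where
  "shift_likelihood g = likelihood (\<lambda>h. F (g \<otimes> h))"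

lemma distr_bernoulli_action:
  assumes g: "g \<in> carrier G"
  shows "distr P P (bernoulli_action G g) = density P (\<lambda>x. ennreal (shift_likelihood (inv g) x))"
proof -
  let ?M = "\<lambda>h. two_point_measure (F h)"
  have "distr P P (bernoulli_action G g) =
      distr (Pi\<^sub>M (carrier G) ?M) (\<Pi>\<^sub>M h\<in>carrier G. ?M (inv g \<otimes> h)) (\<lambda>x. \<lambda>h\<in>carrier G. x (inv g \<otimes> h))"
    unfolding P_def[symmetric]
    by (intro distr_cong) (auto simp: P_def sets_two_point_measure bernoulli_action_def
        space_P[unfolded P_def] intro!: sets_PiM_cong)
  also have "\<dots> = (\<Pi>\<^sub>M h\<in>carrier G. ?M (inv g \<otimes> h))"
    using g M.prob_space_axioms by (intro distr_PiM_reindex inj_onI) auto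
  also have "\<dots> = density P (\<lambda>x. ennreal (shift_likelihood (inv g) x))"
    unfolding shift_likelihood_def
    using g F_pos F_less finite_changed by (intro density_likelihood) auto
  finally show ?thesis .
qed

lemma shift_likelihood_pos: "0 < shift_likelihood g x"
  unfolding shift_likelihood_def by (intro likelihood_pos F_pos F_less)

lemma nonsingular_bernoulli: "nonsingular_action G P (bernoulli_action G)"
  unfolding nonsingular_action_def
proof (intro conjI ballI bernoulli_group_action)
  fix g assume g: "g \<in> carrier G"
  have meas: "(\<lambda>x. ennreal (shift_likelihood (inv g) x)) \<in> borel_measurable P"
    unfolding shift_likelihood_def by measurable
  have pos: "ennreal (shift_likelihood (inv g) x) \<noteq> 0" for x
    using shift_likelihood_pos[of "inv g" x] by simp
  show "null_sets (distr P P (bernoulli_action G g)) = null_sets P"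
    unfolding distr_bernoulli_action[OF g]
  proof (rule Set.set_eqI)
    fix A
    have "A \<in> null_sets (density P (\<lambda>x. ennreal (shift_likelihood (inv g) x))) \<longleftrightarrow>
        A \<in> sets P \<and> (AE x in P. x \<notin> A)"
      unfolding null_sets_density_iff[OF meas] using pos by simp
    also have "\<dots> \<longleftrightarrow> A \<in> null_sets P"
      using AE_iff_null_sets null_setsD2 by blast
    finally show "A \<in> null_sets (density P (\<lambda>x. ennreal (shift_likelihood (inv g) x))) \<longleftrightarrow>
        A \<in> null_sets P" .
  qed
qed (rule measurable_bernoulli_action)

text \<open>
  A telescoping product. To multiply the factors termwise, all three products are extended to one finite set \<open>K\<close>,
  which contains the changed points of \<open>g\<close>, of \<open>k g\<close>, and the translates by \<open>g\<inverse>\<close> of those of \<open>k\<close>.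
\<close>

lemma shift_likelihood_cocycle:
  assumes g: "g \<in> carrier G" and k: "k \<in> carrier G" and x: "x \<in> space P"
  shows "shift_likelihood (k \<otimes> g) x =
    shift_likelihood k (bernoulli_action G g x) * shift_likelihood g x"
proof -
  let ?r = "\<lambda>p q i. point_weight p i / point_weight q i"
  define D where "D k = {h \<in> carrier G. F (k \<otimes> h) \<noteq> F h}" for k
  \<comment> \<open>The changed points of \<open>k\<close> in the coordinates of \<open>x\<close>: coordinate \<open>h\<close> of \<open>g x\<close> is coordinate \<open>g\<inverse> h\<close> of \<open>x\<close>.\<close>
  define S where "S = (\<lambda>h. inv g \<otimes> h) ` D k"
  define K where "K = S \<union> D g \<union> D (k \<otimes> g)"
  have fin: "finite K" "K \<subseteq> carrier G"
    using finite_changed g k by (auto simp: K_def S_def D_def)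
  have inj: "inj_on (\<lambda>h. g \<otimes> h) K"
    using fin g by (intro inj_onI) (auto simp: subset_iff)
  have DS: "D k \<subseteq> (\<lambda>h. g \<otimes> h) ` K"
  proof
    fix h assume h: "h \<in> D k"
    then have "h = g \<otimes> (inv g \<otimes> h)" using g by (simp add: D_def m_assoc[symmetric])
    moreover have "inv g \<otimes> h \<in> K" using h by (auto simp: K_def S_def)
    ultimately show "h \<in> (\<lambda>h. g \<otimes> h) ` K" by blast
  qed
  have "shift_likelihood k (bernoulli_action G g x) =
      (\<Prod>h\<in>(\<lambda>h. g \<otimes> h) ` K. ?r (F (k \<otimes> h)) (F h) (bernoulli_action G g x h))"
    unfolding shift_likelihood_def
    using fin g DS by (intro likelihood_superset) (auto simp: D_def)
  also have "\<dots> = (\<Prod>h\<in>K. ?r (F (k \<otimes> (g \<otimes> h))) (F (g \<otimes> h)) (bernoulli_action G g x (g \<otimes> h)))"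
    by (simp add: prod.reindex[OF inj])
  also have "\<dots> = (\<Prod>h\<in>K. ?r (F ((k \<otimes> g) \<otimes> h)) (F (g \<otimes> h)) (x h))"
  proof (intro prod.cong refl)
    fix h assume "h \<in> K"
    then have "h \<in> carrier G" using fin by auto
    then show "?r (F (k \<otimes> (g \<otimes> h))) (F (g \<otimes> h)) (bernoulli_action G g x (g \<otimes> h)) =
        ?r (F ((k \<otimes> g) \<otimes> h)) (F (g \<otimes> h)) (x h)"
      using g k x by (simp add: bernoulli_action_apply m_assoc) (simp add: m_assoc[symmetric])
  qed
  finally have "shift_likelihood k (bernoulli_action G g x) =
    (\<Prod>h\<in>K. ?r (F ((k \<otimes> g) \<otimes> h)) (F (g \<otimes> h)) (x h))" .
  moreover have "shift_likelihood g x = (\<Prod>h\<in>K. ?r (F (g \<otimes> h)) (F h) (x h))"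
    unfolding shift_likelihood_def
    using fin by (intro likelihood_superset) (auto simp: K_def D_def)
  moreover have "shift_likelihood (k \<otimes> g) x = (\<Prod>h\<in>K. ?r (F ((k \<otimes> g) \<otimes> h)) (F h) (x h))"
    unfolding shift_likelihood_def
    using fin by (intro likelihood_superset) (auto simp: K_def D_def)
  ultimately show ?thesis
    using point_weight_pos by (simp add: prod.distrib[symmetric] less_imp_neq[OF point_weight_pos, symmetric])
qed

lemma sets_less_config:
  assumes [measurable]: "g \<in> carrier G"
  shows "{x \<in> space P. less_config x (bernoulli_action G g x)} \<in> sets P"
proof -
  have [measurable]: "(\<lambda>x. bernoulli_action G g x i) \<in> measurable P (count_space UNIV)" for i
    by (rule measurable_compose[OF measurable_bernoulli_action[OF assms] measurable_coordinate])
  show ?thesis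
    unfolding less_config_def less_fun_def comp_def by measurable
qed

lemma essentially_free_dissipative:
  assumes fin: "AE x in P. finite {g \<in> carrier G. 1 \<le> shift_likelihood g x}"
    and tf: "\<And>H. \<lbrakk>subgroup H G; finite H\<rbrakk> \<Longrightarrow> H = {\<one>}"
  shows "essentially_free G P (bernoulli_action G)" "dissipative G P (bernoulli_action G)"
proof -
  interpret A: group_action G "space P" "bernoulli_action G"
    by (rule bernoulli_group_action)
  interpret A: finite_level_cocycle G P "bernoulli_action G" shift_likelihood
    using fin by unfold_locales (auto simp: shift_likelihood_pos shift_likelihood_cocycle)
  show free: "essentially_free G P (bernoulli_action G)"
    using tf by (rule A.essentially_free_if_no_finite_subgroup)
  show "dissipative G P (bernoulli_action G)"
    using less_config_order sets_less_config
    by (intro A.dissipative_if_essentially_free[OF free]) (auto simp: shift_likelihood_def)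
qed

end

section \<open>The free group on two generators\<close>

lemma suffix_marginal_finite_shift: "finite_shift_bernoulli free_group (suffix_marginal m)"
proof -
  have "0 < suffix_marginal m h" "suffix_marginal m h < 1" for h
    using suffix_marginal_bounds[of m h] by auto
  then show ?thesis
    using finite_changed_words[of m] group_free_group
    by (simp add: finite_shift_bernoulli_def two_point_product_def finite_shift_bernoulli_axioms_def
        changed_words_def)
qed

text \<open>
  The constant is \<open>1 - (1/6)\<^sup>2 / 8\<close>.
\<close>

lemma affinity_suffix_marginal:
  assumes "suffix_marginal m g \<noteq> suffix_marginal m h"
  shows "affinity (suffix_marginal m h) (suffix_marginal m g) \<le> 287/288"
proof -
  let ?p = "suffix_marginal m h" and ?q = "suffix_marginal m g"
  have "(1/6)\<^sup>2 \<le> \<bar>?q - ?p\<bar>\<^sup>2"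
    using suffix_marginal_separated[OF assms] by (intro power_mono) auto
  then have "1/36 \<le> (?p - ?q)\<^sup>2"
    by (simp add: power2_eq_square algebra_simps)
  moreover have "affinity ?p ?q \<le> 1 - (?p - ?q)\<^sup>2 / 8"
    using suffix_marginal_bounds[of m h] suffix_marginal_bounds[of m g] by (intro affinity_le) auto
  ultimately show ?thesis by simp
qed

text \<open>
  Borel-Cantelli over spheres. A word of length \<open>n\<close> changes at least \<open>(n - 1) 2 ^ k\<close> marginals, so it contributes at
  most \<open>(1/8)\<^bsup>n - 1\<^esup>\<close>, and the at most \<open>4 ^ n\<close> words of length \<open>n\<close> together contribute at most \<open>8 (1/2)\<^bsup>n\<^esup>\<close>.
\<close>

lemma AE_finite_superlevel:
  assumes k: "(287/288 :: real) ^ (2 ^ k) \<le> 1/8"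
  defines "F \<equiv> suffix_marginal (Suc k)"
  shows "AE x in bernoulli_space F2 F.
    finite {g \<in> carrier F2. 1 \<le> finite_shift_bernoulli.shift_likelihood F2 F g x}"
proof -
  interpret finite_shift_bernoulli F2 F
    unfolding F_def by (rule suffix_marginal_finite_shift)
  interpret prod: prob_space P
    unfolding P_def by (rule P.prob_space_axioms)
  let ?S = "\<lambda>n. {g :: (bool \<times> bool) list. reduced_word g \<and> length g = n}"
  define E where "E n = {x \<in> space P. \<exists>g\<in>?S n. 1 \<le> shift_likelihood g x}" for n
  have [measurable]: "shift_likelihood g \<in> borel_measurable P" for g
    unfolding shift_likelihood_def by measurable
  have lists: "finite {g :: (bool \<times> bool) list. set g \<subseteq> UNIV \<and> length g = n}"
    "card {g :: (bool \<times> bool) list. set g \<subseteq> UNIV \<and> length g = n} = 4 ^ n" for n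
    by (rule finite_lists_length_eq, simp, subst card_lists_length_eq, simp_all)
  have S: "finite (?S n)" "card (?S n) \<le> 4 ^ n" for n
    using finite_subset[OF _ lists(1)[of n], of "?S n"] card_mono[OF lists(1)[of n], of "?S n"] lists(2)[of n]
    by auto
  have E_eq: "E n = (\<Union>g\<in>?S n. {x \<in> space P. 1 \<le> shift_likelihood g x})" for n
    by (auto simp: E_def)
  have E_sets [measurable]: "E n \<in> sets P" for n
    unfolding E_eq using S by (intro sets.finite_UN) measurable
  have sphere: "measure P {x \<in> space P. 1 \<le> shift_likelihood g x} \<le> (1/8) ^ (n - 1)"
    if g: "g \<in> ?S n" for g n
  proof -
    have gc: "g \<in> carrier F2" using g by (simp add: free_group_def)
    have "measure P {x \<in> space P. 1 \<le> shift_likelihood g x} \<le>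
        (287/288) ^ card {h \<in> carrier F2. F (g \<otimes>\<^bsub>F2\<^esub> h) \<noteq> F h}"
      unfolding shift_likelihood_def
      using finite_changed[OF gc] affinity_suffix_marginal
      by (intro prob_likelihood_ge_1) (auto simp: F_pos F_less, auto simp: F_def)
    also have "{h \<in> carrier F2. F (g \<otimes>\<^bsub>F2\<^esub> h) \<noteq> F h} = changed_words (Suc k) g"
      by (simp add: changed_words_def F_def)
    also have "(287/288 :: real) ^ card (changed_words (Suc k) g) \<le> (287/288) ^ ((n - 1) * 2 ^ k)"
      using card_changed_words[of g k] g by (intro power_decreasing) auto
    also have "\<dots> = ((287/288) ^ (2 ^ k)) ^ (n - 1)"
      by (simp add: power_mult[symmetric] mult.commute)
    also have "\<dots> \<le> (1/8) ^ (n - 1)"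
      using k by (intro power_mono) auto
    finally show ?thesis .
  qed
  have bound: "measure P (E n) \<le> 8 * (1/2) ^ n" for n
  proof -
    have "measure P (E n) \<le> (\<Sum>g\<in>?S n. measure P {x \<in> space P. 1 \<le> shift_likelihood g x})"
      unfolding E_eq using S by (intro prod.finite_measure_subadditive_finite) auto
    also have "\<dots> \<le> of_nat (card (?S n)) * (1/8) ^ (n - 1)"
      using sphere by (intro sum_bounded_above) auto
    also have "\<dots> \<le> of_nat (4 ^ n) * (1/8) ^ (n - 1)"
      using S by (intro mult_right_mono of_nat_mono) auto
    also have "\<dots> \<le> 8 * (1/2) ^ n"
    proof (cases n)
      case (Suc j)
      have "(4::real) ^ j * (1/8) ^ j = (1/2) ^ j"
        unfolding power_mult_distrib[symmetric] by simp
      then show ?thesis by (simp add: Suc)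
    qed simp
    finally show ?thesis .
  qed
  have "summable (\<lambda>n. measure P (E n))"
  proof (rule summable_comparison_test'[where g = "\<lambda>n. 8 * (1/2) ^ n" and N = 0])
    show "summable (\<lambda>n. 8 * (1/2 :: real) ^ n)"
      by (rule summable_mult) (simp add: summable_geometric)
    show "norm (measure P (E n)) \<le> 8 * (1/2) ^ n" for n
      using bound[of n] by simp
  qed
  then have "AE x in P. eventually (\<lambda>n. x \<in> space P - E n) sequentially"
    by (intro borel_cantelli_AE1) (auto simp: prod.emeasure_finite less_top[symmetric])
  then have "AE x in P. finite {g \<in> carrier F2. 1 \<le> shift_likelihood g x}"
  proof eventually_elim
    case (elim x)
    then obtain N where N: "\<And>n. N \<le> n \<Longrightarrow> x \<in> space P - E n"
      by (auto simp: eventually_sequentially)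
    have "length g < N" if "g \<in> carrier F2" "1 \<le> shift_likelihood g x" for g
      using N[of "length g"] that by (force simp: E_def free_group_def)
    then have "{g \<in> carrier F2. 1 \<le> shift_likelihood g x} \<subseteq> (\<Union>n<N. ?S n)"
      by (auto simp: free_group_def)
    then show ?case by (rule finite_subset) (use S in auto)
  qed
  then show ?thesis unfolding bernoulli_space_eq .
qed

theorem proposition7p7:
  shows "\<exists>F :: (bool \<times> bool) list \<Rightarrow> real.
           F \<in> carrier F2 \<rightarrow> {1/4..3/4} \<and>
           nonsingular_action F2 (bernoulli_space F2 F) (bernoulli_action F2) \<and>
           essentially_free F2 (bernoulli_space F2 F) (bernoulli_action F2) \<and>
           dissipative F2 (bernoulli_space F2 F) (bernoulli_action F2)"
proof -
  \<comment> \<open>A power of \<open>287/288\<close> below \<open>1/8\<close> leaves a factor \<open>1/2\<close> to spare against the growth rate \<open>4\<close>.\<close>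
  obtain k :: nat where "(287/288 :: real) ^ k < 1/8"
    using real_arch_pow_inv[of "1/8" "287/288"] by auto
  moreover have "(287/288 :: real) ^ (2 ^ k) \<le> (287/288) ^ k"
    by (intro power_decreasing) (auto intro: less_imp_le)
  ultimately have k: "(287/288 :: real) ^ (2 ^ k) \<le> 1/8" by linarith
  define F where "F = suffix_marginal (Suc k)"
  interpret finite_shift_bernoulli F2 F
    unfolding F_def by (rule suffix_marginal_finite_shift)
  have fin: "AE x in P. finite {g \<in> carrier F2. 1 \<le> shift_likelihood g x}"
    using AE_finite_superlevel[OF k, folded F_def] unfolding bernoulli_space_eq .
  have tf: "H = {\<one>\<^bsub>F2\<^esub>}" if "subgroup H F2" "finite H" for H
    using finite_subgroup_free_group[OF that] by (simp add: free_group_def)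
  have "F \<in> carrier F2 \<rightarrow> {1/4..3/4}"
    unfolding F_def using suffix_marginal_bounds by blast
  then show ?thesis
    using nonsingular_bernoulli essentially_free_dissipative[OF fin tf] by (auto simp: bernoulli_space_eq)
qed

end
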